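(* There is a constant $c$ such that for every $n$ and every set $S$ of $n$ points in $\mathbb{R}^3$, no three of which are collinear, the number of coplanar $4$-element subsets of $S$ plus the number of $5$-element subsets of $S$ containing no coplanar $4$-element subset is at least $\binom{n}{4}-c\,n^3$. (That is, this quantity is at least $\binom{n}{4}-O(n^3)$ as $n\to\infty$.)
   Context: A $4$-element set of points is coplanar if it is contained in a $2$-dimensional affine subspace of $\mathbb{R}^3$. *)

theory Defs
  imports "HOL-Analysis.Analysis"
begin

text \<open>
  The library defines \<^const>\<open>coplanar\<close> as being contained in the affine hull of at most three
  points.  In three-dimensional space this is containment in a 2-dimensional affine subspace.
\<close>

lemma coplanar_iff_subset_plane:
  fixes S :: "(real^3) set"
  shows "coplanar S \<longleftrightarrow> (\<exists>P. affine P \<and> aff_dim P = 2 \<and> S \<subseteq> P)"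
proof
  assume "coplanar S"
  then obtain u v w where S: "S \<subseteq> affine hull {u, v, w}"
    by (auto simp: coplanar_def)
  have "aff_dim S \<le> aff_dim {u, v, w}"
    using aff_dim_subset[OF S] by simp
  also have "\<dots> \<le> int (card {u, v, w}) - 1"
    by (rule aff_dim_le_card) simp
  also have "\<dots> \<le> 2"
    by (simp add: card_insert_if)
  finally have "aff_dim S < int DIM(real^3)"
    by simp
  then obtain a b where "a \<noteq> 0" "S \<subseteq> {x. a \<bullet> x = b}"
    using aff_lowdim_subset_hyperplane by blast
  then show "\<exists>P. affine P \<and> aff_dim P = 2 \<and> S \<subseteq> P"
    by (intro exI[of _ "{x. a \<bullet> x = b}"]) (simp add: affine_hyperplane)
next
  assume "\<exists>P. affine P \<and> aff_dim P = 2 \<and> S \<subseteq> P"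
  then obtain P where P: "affine P" "aff_dim P = 2" "S \<subseteq> P"
    by blast
  obtain B where B: "affine hull B = affine hull P" "int (card B) = aff_dim P + 1"
    using aff_dim_basis_exists by metis
  then have "card B = 3"
    using P(2) by simp
  then obtain u v w where "B = {u, v, w}"
    by (auto simp: card_3_iff)
  then have "S \<subseteq> affine hull {u, v, w}"
    using B(1) P(3) hull_subset[of P affine] by auto
  then show "coplanar S"
    by (auto simp: coplanar_def)
qed

end

theory Submission
  imports Defs
begin

text \<open>
  Call a non-coplanar \<open>4\<close>-subset of \<open>S\<close> a \<^emph>\<open>basis\<close>, and a \<open>5\<close>-subset without coplanar \<open>4\<close>-subset a
  \<^emph>\<open>circuit\<close>.  Since the \<open>4\<close>-subsets that are not bases are coplanar, the claim says that there are at
  least as many circuits as bases, up to an error \<open>O(n^3)\<close>.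

  A basis \<open>B\<close> together with a point \<open>p\<close> is a circuit as soon as \<open>p\<close> lies on none of the four face
  planes of the tetrahedron \<open>B\<close>.  Each circuit arises in this way from five pairs \<open>(B, p)\<close>.  Hence
  there are at most as many bases with at least five points of \<open>S\<close> off their face planes as there
  are circuits (\<open>card_bases_le\<close>), and what remains is to show that the \<^emph>\<open>deficient\<close> bases, those with at
  most four such points, are only \<open>O(n^3)\<close> in number (\<open>card_deficient_le\<close>).

  As no three points are collinear, two distinct planes share at most two points of \<open>S\<close>.  So a plane
  that is not a face of a deficient basis \<open>B\<close> has at most \<open>4 + 4 * 2 = 12\<close> points: every plane with
  more points, called \<^emph>\<open>rich\<close>, is a face plane of every deficient basis.  If there are two rich
  planes, then every deficient basis contains one of their at most two common points, because
  any two faces of a tetrahedron share vertices.  If there is at most one rich plane and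
  there is a deficient basis at all, then its four face planes and four further points cover \<open>S\<close>, so
  one plane contains all but a bounded number of points of \<open>S\<close>; and every basis, deficient
  or not, has a vertex off that plane.  In both cases all deficient bases meet a fixed set of bounded
  size, and only \<open>O(n^3)\<close> sets of size \<open>4\<close> do.
\<close>

section \<open>Sets of size four meeting a small set\<close>

lemma card_4_subsets_meeting_le:
  assumes "finite S" and "R \<subseteq> S"
    and meet: "\<And>B. B \<in> F \<Longrightarrow> B \<subseteq> S \<and> card B = 4 \<and> B \<inter> R \<noteq> {}"
  shows "card F \<le> card R * card S ^ 3"
proof -
  let ?triples = "{T. T \<subseteq> S \<and> card T = 3}"
  have fin: "finite R" "finite ?triples"
    using assms by (auto intro: finite_subset)
  have "F \<subseteq> (\<lambda>(r, T). insert r T) ` (R \<times> ?triples)"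
  proof
    fix B assume "B \<in> F"
    then obtain r where r: "r \<in> B" "r \<in> R" and B: "B \<subseteq> S" "card B = 4"
      using meet by blast
    then have "B - {r} \<in> ?triples" by auto
    then show "B \<in> (\<lambda>(r, T). insert r T) ` (R \<times> ?triples)"
      using r by (intro image_eqI[of _ _ "(r, B - {r})"]) auto
  qed
  then have "card F \<le> card (R \<times> ?triples)"
    using fin by (meson card_image_le card_mono finite_SigmaI finite_imageI order_trans)
  also have "\<dots> = card R * (card S choose 3)"
    using n_subsets[OF \<open>finite S\<close>] by (simp add: card_cartesian_product)
  also have "\<dots> \<le> card R * card S ^ 3"
    by (cases "3 \<le> card S") (simp_all add: binomial_le_pow binomial_eq_0)
  finally show ?thesis .
qed

section \<open>Finite point sets in which three points span a plane\<close>

text \<open>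
  The argument is purely combinatorial: all that matters about planes is that any three
  points of a plane determine it.  Here \<open>plane T\<close> stands for the set of those points of \<open>S\<close>
  that lie on the plane spanned by the triple \<open>T\<close>.
\<close>

locale planes_of_triples =
  fixes S :: "'a set" and plane :: "'a set \<Rightarrow> 'a set"
  assumes finite_points: "finite S"
    and plane_subset: "plane T \<subseteq> S"
    and triple_subset_plane: "T \<subseteq> S \<Longrightarrow> card T = 3 \<Longrightarrow> T \<subseteq> plane T"
    and plane_unique: "T \<subseteq> S \<Longrightarrow> card T = 3 \<Longrightarrow> T' \<subseteq> plane T \<Longrightarrow> card T' = 3 \<Longrightarrow> plane T' = plane T"
begin

definition flat :: "'a set \<Rightarrow> bool" where
  "flat U \<longleftrightarrow> (\<exists>T. T \<subseteq> S \<and> card T = 3 \<and> U \<subseteq> plane T)"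

definition bases :: "'a set set" where
  "bases = {B. B \<subseteq> S \<and> card B = 4 \<and> \<not> flat B}"

definition circuits :: "'a set set" where
  "circuits = {Q. Q \<subseteq> S \<and> card Q = 5 \<and> \<not> (\<exists>T. T \<subseteq> Q \<and> card T = 4 \<and> flat T)}"

definition faces :: "'a set \<Rightarrow> 'a set set" where
  "faces B = {T. T \<subseteq> B \<and> card T = 3}"

definition off_faces :: "'a set \<Rightarrow> 'a set" where
  "off_faces B = S - (\<Union>T\<in>faces B. plane T)"

definition deficient :: "'a set set" where
  "deficient = {B \<in> bases. card (off_faces B) \<le> 4}"

lemma finite_plane: "finite (plane T)"
  using finite_points plane_subset finite_subset by blast

lemma finite_off_faces: "finite (off_faces B)"
  using finite_points by (simp add: off_faces_def)

lemma finite_bases: "finite bases"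
  using finite_points by (simp add: bases_def)

lemma finite_circuits: "finite circuits"
  using finite_points by (simp add: circuits_def)

lemma basisD:
  assumes "B \<in> bases"
  shows "B \<subseteq> S" "card B = 4" "finite B" "\<not> flat B"
  using assms finite_points by (auto simp: bases_def intro: finite_subset)

lemma faceD:
  assumes "B \<in> bases" "T \<in> faces B"
  shows "T \<subseteq> B" "T \<subseteq> S" "card T = 3" "T \<subseteq> plane T"
  using assms basisD(1)[of B] triple_subset_plane by (auto simp: faces_def)

lemma faces_of_basis:
  assumes "B \<in> bases"
  shows "finite (faces B)" "card (faces B) = 4"
proof -
  show "finite (faces B)"
    using basisD(3)[OF assms] by (simp add: faces_def)
  show "card (faces B) = 4"
    using n_subsets[OF basisD(3)[OF assms], of 3] basisD(2)[OF assms]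
    by (simp add: faces_def eval_nat_numeral)
qed

lemma vertex_in_face:
  assumes "B \<in> bases" "p \<in> B"
  shows "\<exists>T\<in>faces B. p \<in> T"
proof -
  have "card (B - {p}) = 3"
    using assms basisD(2)[OF assms(1)] by simp
  then have "B - {p} \<noteq> {}"
    by (metis card.empty zero_neq_numeral)
  then obtain q where "q \<in> B" "q \<noteq> p" by blast
  then have "p \<in> B - {q}" "B - {q} \<in> faces B"
    using assms basisD[OF assms(1)] by (auto simp: faces_def)
  then show ?thesis by (rule bexI)
qed

lemma basis_subset_face_planes:
  assumes "B \<in> bases"
  shows "B \<subseteq> (\<Union>T\<in>faces B. plane T)"
  using vertex_in_face[OF assms] faceD(4)[OF assms] by blast

lemma card_Int_planes_le_2:
  assumes T: "T \<subseteq> S" "card T = 3" and T': "T' \<subseteq> S" "card T' = 3"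
    and ne: "plane T \<noteq> plane T'"
  shows "card (plane T \<inter> plane T') \<le> 2"
proof (rule ccontr)
  assume "\<not> ?thesis"
  then have "3 \<le> card (plane T \<inter> plane T')"
    by simp
  then obtain U where "U \<subseteq> plane T \<inter> plane T'" "card U = 3"
    by (rule obtain_subset_with_card_n)
  then show False
    using plane_unique[OF T, of U] plane_unique[OF T', of U] ne by auto
qed

lemma faces_meet:
  assumes "B \<in> bases" "T \<in> faces B" "T' \<in> faces B"
  shows "T \<inter> T' \<noteq> {}"
proof
  assume "T \<inter> T' = {}"
  then have "card (T \<union> T') = 6"
    using faceD(3)[OF assms(1)] assms(2,3) by (subst card_Un_disjoint) (auto intro!: card_ge_0_finite)
  moreover have "card (T \<union> T') \<le> 4"
    using card_mono[of B "T \<union> T'"] faceD(1)[OF assms(1)] assms basisD(2,3) by fastforce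
  ultimately show False by simp
qed

section \<open>Comparing bases with circuits\<close>

text \<open>
  A coplanar \<open>4\<close>-subset of \<open>insert p B\<close> other than \<open>B\<close> consists of \<open>p\<close> and three vertices of \<open>B\<close>, so
  it puts \<open>p\<close> on the face plane through these vertices.
\<close>

lemma insert_off_faces_is_circuit:
  assumes B: "B \<in> bases" and p: "p \<in> off_faces B"
  shows "insert p B \<in> circuits" "p \<notin> B"
proof -
  show pB: "p \<notin> B"
    using p basis_subset_face_planes[OF B] by (auto simp: off_faces_def)
  have "\<not> flat U" if U: "U \<subseteq> insert p B" "card U = 4" for U
  proof
    assume "flat U"
    then obtain T' where T': "T' \<subseteq> S" "card T' = 3" "U \<subseteq> plane T'"
      by (auto simp: flat_def)
    show False
    proof (cases "p \<in> U")
      case True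
      then have "U - {p} \<in> faces B"
        using U by (auto simp: faces_def)
      moreover from this have "plane (U - {p}) = plane T'"
        using T' plane_unique[of T' "U - {p}"] by (auto simp: faces_def)
      ultimately show False
        using p True T'(3) by (auto simp: off_faces_def)
    next
      case False
      then have "U = B"
        using U basisD[OF B] by (intro card_subset_eq) auto
      then show False
        using \<open>flat U\<close> basisD(4)[OF B] by simp
    qed
  qed
  then show "insert p B \<in> circuits"
    using pB p basisD[OF B] by (auto simp: circuits_def off_faces_def)
qed

lemma sum_card_off_faces_le: "(\<Sum>B\<in>bases. card (off_faces B)) \<le> 5 * card circuits"
proof -
  let ?pairs = "SIGMA B:bases. off_faces B"
  let ?pointed = "SIGMA Q:circuits. Q"
  have fin_circuit: "finite Q" if "Q \<in> circuits" for Q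
    using that finite_points by (auto simp: circuits_def intro: finite_subset)
  then have fin: "finite ?pointed"
    using finite_circuits by (intro finite_SigmaI)
  \<comment> \<open>Keeping \<open>p\<close> beside \<open>insert p B\<close> lets \<open>B\<close> be recovered, as \<open>p\<close> is not a vertex of \<open>B\<close>.\<close>
  have "inj_on (\<lambda>(B, p). (insert p B, p)) ?pairs"
    by (intro inj_onI) (clarsimp simp: insert_ident insert_off_faces_is_circuit(2))
  moreover have "(\<lambda>(B, p). (insert p B, p)) ` ?pairs \<subseteq> ?pointed"
    using insert_off_faces_is_circuit(1) by auto
  ultimately have "card ?pairs \<le> card ?pointed"
    using fin card_inj_on_le by blast
  also have "card ?pointed = (\<Sum>Q\<in>circuits. card Q)"
    using finite_circuits fin_circuit by (intro card_SigmaI) auto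
  also have "\<dots> = 5 * card circuits"
    by (simp add: circuits_def)
  finally show ?thesis
    using finite_bases finite_off_faces by (simp add: card_SigmaI)
qed

lemma card_bases_le: "card bases \<le> card circuits + card deficient"
proof -
  have def: "deficient \<subseteq> bases"
    by (auto simp: deficient_def)
  have "5 * card (bases - deficient) = (\<Sum>B\<in>bases - deficient. 5)"
    by simp
  also have "\<dots> \<le> (\<Sum>B\<in>bases - deficient. card (off_faces B))"
    by (rule sum_mono) (auto simp: deficient_def)
  also have "\<dots> \<le> (\<Sum>B\<in>bases. card (off_faces B))"
    using finite_bases by (intro sum_mono2) auto
  also have "\<dots> \<le> 5 * card circuits"
    by (rule sum_card_off_faces_le)
  finally have "card (bases - deficient) \<le> card circuits"
    by simp
  moreover have "card (bases - deficient) = card bases - card deficient"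
    using def finite_bases by (intro card_Diff_subset) (auto intro: finite_subset)
  ultimately show ?thesis by linarith
qed

section \<open>Deficient bases\<close>

text \<open>
  A plane other than the four face planes of \<open>B\<close> has at most two points in common with each of them,
  and all its remaining points are off the face planes.
\<close>

lemma rich_plane_is_face_plane:
  assumes B: "B \<in> deficient" and T: "T \<subseteq> S" "card T = 3" and rich: "card (plane T) \<ge> 13"
  shows "\<exists>T'\<in>faces B. plane T' = plane T"
proof (rule ccontr)
  assume neg: "\<not> ?thesis"
  have basis: "B \<in> bases" and off: "card (off_faces B) \<le> 4"
    using B by (auto simp: deficient_def)
  let ?traces = "\<Union>T'\<in>faces B. plane T \<inter> plane T'"
  have "card ?traces \<le> (\<Sum>T'\<in>faces B. card (plane T \<inter> plane T'))"
    using faces_of_basis(1)[OF basis] by (rule card_UN_le)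
  also have "\<dots> \<le> of_nat (card (faces B)) * 2"
    using T neg faceD[OF basis] by (intro sum_bounded_above card_Int_planes_le_2) auto
  finally have traces: "card ?traces \<le> 8"
    by (simp add: faces_of_basis(2)[OF basis])
  have "plane T \<subseteq> off_faces B \<union> ?traces"
    using plane_subset[of T] by (auto simp: off_faces_def)
  then have "card (plane T) \<le> card (off_faces B \<union> ?traces)"
    using finite_off_faces finite_plane faces_of_basis(1)[OF basis] by (intro card_mono) auto
  also have "\<dots> \<le> card (off_faces B) + card ?traces"
    by (rule card_Un_le)
  finally show False
    using rich off traces by linarith
qed

lemma card_deficient_le_two_rich_planes:
  assumes T1: "T1 \<subseteq> S" "card T1 = 3" "card (plane T1) \<ge> 13"
    and T2: "T2 \<subseteq> S" "card T2 = 3" "card (plane T2) \<ge> 13"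
    and ne: "plane T1 \<noteq> plane T2"
  shows "card deficient \<le> 2 * card S ^ 3"
proof -
  let ?R = "plane T1 \<inter> plane T2"
  have "card deficient \<le> card ?R * card S ^ 3"
  proof (rule card_4_subsets_meeting_le[OF finite_points])
    show "?R \<subseteq> S"
      using plane_subset by blast
    fix B assume B: "B \<in> deficient"
    then have basis: "B \<in> bases"
      by (simp add: deficient_def)
    obtain T1' T2' where "T1' \<in> faces B" "plane T1' = plane T1" "T2' \<in> faces B" "plane T2' = plane T2"
      using rich_plane_is_face_plane[OF B T1] rich_plane_is_face_plane[OF B T2] by blast
    then have "B \<inter> ?R \<noteq> {}"
      using faces_meet[OF basis, of T1' T2'] faceD(1,4)[OF basis] by blast
    then show "B \<subseteq> S \<and> card B = 4 \<and> B \<inter> ?R \<noteq> {}"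
      using basisD[OF basis] by blast
  qed
  also have "\<dots> \<le> 2 * card S ^ 3"
    using card_Int_planes_le_2[OF T1(1,2) T2(1,2) ne] by (rule mult_right_mono) simp
  finally show ?thesis .
qed

text \<open>
  The plane \<open>P\<close> that contains almost all points is a rich face plane of \<open>B0\<close> if there is one, and an
  arbitrary face plane otherwise.  Off \<open>P\<close> there are at most four points off the faces of \<open>B0\<close> and at
  most \<open>12\<close> points on each of the remaining face planes, hence at most \<open>4 + 4 * 12 = 52\<close> points.
\<close>

lemma card_deficient_le_one_rich_plane:
  assumes B0: "B0 \<in> deficient"
    and one: "\<And>T T'. \<lbrakk>T \<subseteq> S; card T = 3; card (plane T) \<ge> 13; T' \<subseteq> S; card T' = 3; card (plane T') \<ge> 13\<rbrakk>
                \<Longrightarrow> plane T = plane T'"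
  shows "card deficient \<le> 52 * card S ^ 3"
proof -
  have basis: "B0 \<in> bases" and off: "card (off_faces B0) \<le> 4"
    using B0 by (auto simp: deficient_def)
  have "faces B0 \<noteq> {}"
    using faces_of_basis[OF basis] by auto
  then obtain T0 where T0: "T0 \<in> faces B0"
    and others: "\<And>T. \<lbrakk>T \<in> faces B0; plane T \<noteq> plane T0\<rbrakk> \<Longrightarrow> card (plane T) \<le> 12"
  proof (cases "\<exists>T\<in>faces B0. card (plane T) \<ge> 13")
    case True
    then obtain T where T: "T \<in> faces B0" "card (plane T) \<ge> 13" by blast
    have "card (plane T') \<le> 12" if "T' \<in> faces B0" "plane T' \<noteq> plane T" for T'
      using one[of T T'] T that faceD(2,3)[OF basis] by fastforce
    then show ?thesis
      using T(1) that by blast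
  next
    case False
    then have "card (plane T) \<le> 12" if "T \<in> faces B0" for T
      using that by fastforce
    then show ?thesis
      using \<open>faces B0 \<noteq> {}\<close> that by blast
  qed
  let ?P = "plane T0"
  let ?poor = "{T \<in> faces B0. plane T \<noteq> ?P}"
  have fin: "finite ?poor"
    using faces_of_basis(1)[OF basis] by simp
  have "card (\<Union>T\<in>?poor. plane T) \<le> (\<Sum>T\<in>?poor. card (plane T))"
    using fin by (rule card_UN_le)
  also have "\<dots> \<le> of_nat (card ?poor) * 12"
    using others by (intro sum_bounded_above) auto
  also have "\<dots> \<le> 4 * 12"
    using card_mono[of "faces B0" ?poor] faces_of_basis[OF basis] by auto
  finally have poor: "card (\<Union>T\<in>?poor. plane T) \<le> 48"
    by simp
  have "S - ?P \<subseteq> off_faces B0 \<union> (\<Union>T\<in>?poor. plane T)"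
    by (auto simp: off_faces_def)
  then have "card (S - ?P) \<le> card (off_faces B0 \<union> (\<Union>T\<in>?poor. plane T))"
    using finite_off_faces finite_plane fin by (intro card_mono) auto
  also have "\<dots> \<le> card (off_faces B0) + card (\<Union>T\<in>?poor. plane T)"
    by (rule card_Un_le)
  finally have R: "card (S - ?P) \<le> 52"
    using off poor by linarith
  have "card deficient \<le> card (S - ?P) * card S ^ 3"
  proof (rule card_4_subsets_meeting_le[OF finite_points])
    fix B assume "B \<in> deficient"
    then have "B \<in> bases"
      by (simp add: deficient_def)
    then have "\<not> B \<subseteq> ?P"
      using basisD(4) faceD(2,3)[OF basis T0] by (auto simp: flat_def)
    then show "B \<subseteq> S \<and> card B = 4 \<and> B \<inter> (S - ?P) \<noteq> {}"
      using basisD(1,2)[OF \<open>B \<in> bases\<close>] by blast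
  qed auto
  also have "\<dots> \<le> 52 * card S ^ 3"
    using R by (rule mult_right_mono) simp
  finally show ?thesis .
qed

lemma card_deficient_le: "card deficient \<le> 52 * card S ^ 3"
proof (cases "deficient = {}")
  case False
  then obtain B0 where B0: "B0 \<in> deficient" by blast
  show ?thesis
  proof (cases "\<exists>T T'. T \<subseteq> S \<and> card T = 3 \<and> card (plane T) \<ge> 13 \<and> T' \<subseteq> S \<and> card T' = 3 \<and>
                   card (plane T') \<ge> 13 \<and> plane T \<noteq> plane T'")
    case True
    then have "card deficient \<le> 2 * card S ^ 3"
      using card_deficient_le_two_rich_planes by blast
    then show ?thesis by linarith
  next
    case False
    then show ?thesis
      using card_deficient_le_one_rich_plane[OF B0] by blast
  qed
qed simp

theorem choose_4_le_flats_plus_circuits: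
  "card S choose 4 \<le> card {T. T \<subseteq> S \<and> card T = 4 \<and> flat T} + card circuits + 52 * card S ^ 3"
proof -
  let ?flats = "{T. T \<subseteq> S \<and> card T = 4 \<and> flat T}"
  have "card S choose 4 = card {T. T \<subseteq> S \<and> card T = 4}"
    using n_subsets[OF finite_points] by simp
  also have "{T. T \<subseteq> S \<and> card T = 4} = ?flats \<union> bases"
    by (auto simp: bases_def)
  also have "card \<dots> \<le> card ?flats + card bases"
    by (rule card_Un_le)
  finally show ?thesis
    using card_bases_le card_deficient_le by linarith
qed

end

section \<open>Planes in Euclidean space\<close>

lemma affine_hull_eq_if_noncollinear_triples:
  fixes T T' :: "'a::euclidean_space set"
  assumes "card T = 3" and "card T' = 3" and "\<not> collinear T'" and sub: "T' \<subseteq> affine hull T"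
  shows "affine hull T' = affine hull T"
proof -
  have "aff_dim T \<le> int (card T) - 1"
    using assms(1) by (intro aff_dim_le_card) (simp add: card_ge_0_finite)
  moreover have "aff_dim T' \<ge> 2"
    using assms(3) by (simp add: collinear_aff_dim)
  moreover have hull: "affine hull T' \<subseteq> affine hull T"
    using sub by (simp add: hull_minimal)
  ultimately show ?thesis
    using assms(1) aff_dim_psubset[of T' T] by auto
qed

text \<open>
  The three points that witness coplanarity need not belong to \<open>U\<close>; this replaces them by
  three points of \<open>U\<close> itself.
\<close>

lemma coplanar_iff_subset_affine_hull_triple:
  fixes U :: "'a::euclidean_space set"
  assumes "card T = 3" and "T \<subseteq> U" and "\<not> collinear T"
  shows "coplanar U \<longleftrightarrow> U \<subseteq> affine hull T"
proof
  assume "coplanar U"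
  then obtain u v w where U: "U \<subseteq> affine hull {u, v, w}"
    by (auto simp: coplanar_def)
  \<comment> \<open>The points \<open>u\<close>, \<open>v\<close>, \<open>w\<close> are distinct, for otherwise they would span at most a line.\<close>
  have "\<not> collinear {u, v, w}"
    using U assms(2,3) collinear_subset[of "affine hull {u, v, w}" T]
    by (auto simp: collinear_affine_hull_collinear)
  then have "u \<noteq> v" "v \<noteq> w" "u \<noteq> w"
    by (auto simp: insert_commute)
  then have "card {u, v, w} = 3"
    by simp
  then show "U \<subseteq> affine hull T"
    using affine_hull_eq_if_noncollinear_triples[of "{u, v, w}" T] U assms by auto
next
  assume "U \<subseteq> affine hull T"
  moreover obtain u v w where "T = {u, v, w}"
    using assms(1) by (auto simp: card_3_iff)
  ultimately show "coplanar U"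
    by (auto simp: coplanar_def)
qed

lemma planes_of_triples_affine_hull:
  fixes S :: "'a::euclidean_space set"
  assumes "finite S" and gen: "\<And>T. T \<subseteq> S \<Longrightarrow> card T = 3 \<Longrightarrow> \<not> collinear T"
  shows "planes_of_triples S (\<lambda>T. S \<inter> affine hull T)"
proof
  fix T T' :: "'a set"
  assume T: "T \<subseteq> S" "card T = 3"
  then show "T \<subseteq> S \<inter> affine hull T"
    by (simp add: hull_subset)
  assume "T' \<subseteq> S \<inter> affine hull T" "card T' = 3"
  then show "S \<inter> affine hull T' = S \<inter> affine hull T"
    using affine_hull_eq_if_noncollinear_triples[of T T'] T gen[of T'] by auto
qed (use assms in auto)

theorem corollary4:
  shows "\<exists>c::real. \<forall>(n::nat) (S::(real^3) set).
    finite S \<and> card S = n \<and> (\<forall>T. T \<subseteq> S \<and> card T = 3 \<longrightarrow> \<not> collinear T) \<longrightarrow>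
      real (card {T. T \<subseteq> S \<and> card T = 4 \<and> coplanar T})
      + real (card {Q. Q \<subseteq> S \<and> card Q = 5 \<and>
                     \<not> (\<exists>T. T \<subseteq> Q \<and> card T = 4 \<and> coplanar T)})
      \<ge> real (n choose 4) - c * real n ^ 3"
proof (intro exI[of _ 52] allI impI)
  fix n :: nat and S :: "(real^3) set"
  assume "finite S \<and> card S = n \<and> (\<forall>T. T \<subseteq> S \<and> card T = 3 \<longrightarrow> \<not> collinear T)"
  then have fin: "finite S" and n: "card S = n"
    and gen: "\<And>T. T \<subseteq> S \<Longrightarrow> card T = 3 \<Longrightarrow> \<not> collinear T"
    by auto
  interpret planes_of_triples S "\<lambda>T. S \<inter> affine hull T"
    using fin gen by (rule planes_of_triples_affine_hull)
  have flat_iff: "flat U \<longleftrightarrow> coplanar U" if U: "U \<subseteq> S" "card U = 4" for U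
  proof
    assume "flat U"
    then obtain T where "card T = 3" "U \<subseteq> affine hull T"
      by (auto simp: flat_def)
    then show "coplanar U"
      by (auto simp: coplanar_def card_3_iff)
  next
    assume "coplanar U"
    have "3 \<le> card U"
      using U(2) by simp
    then obtain T where T: "T \<subseteq> U" "card T = 3"
      by (rule obtain_subset_with_card_n)
    then have "U \<subseteq> affine hull T"
      using coplanar_iff_subset_affine_hull_triple[of T U] \<open>coplanar U\<close> gen[of T] U by auto
    then show "flat U"
      using T U by (auto simp: flat_def)
  qed
  have flats: "{T. T \<subseteq> S \<and> card T = 4 \<and> flat T} = {T. T \<subseteq> S \<and> card T = 4 \<and> coplanar T}"
    using flat_iff by blast
  have circs: "circuits = {Q. Q \<subseteq> S \<and> card Q = 5 \<and> \<not> (\<exists>T. T \<subseteq> Q \<and> card T = 4 \<and> coplanar T)}"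
    unfolding circuits_def using flat_iff by (meson subset_trans)
  have "real (n choose 4) \<le> real (card {T. T \<subseteq> S \<and> card T = 4 \<and> flat T} + card circuits + 52 * n ^ 3)"
    using choose_4_le_flats_plus_circuits unfolding n by (rule of_nat_mono)
  then show "real (n choose 4) - 52 * real n ^ 3
      \<le> real (card {T. T \<subseteq> S \<and> card T = 4 \<and> coplanar T})
        + real (card {Q. Q \<subseteq> S \<and> card Q = 5 \<and> \<not> (\<exists>T. T \<subseteq> Q \<and> card T = 4 \<and> coplanar T)})"
    unfolding flats circs by simp
qed

end
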